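(* Let $d=3$. For every integer $n\ge 3$ the inequality $\mathbb{E}_{\mathrm{wo},3}(\mathcal{A})\le \mathbb{E}_{\mathrm{wr},3}(\mathcal{A})$ fails in general; that is, for every $n\geq 3$ there exist a Hilbert space $H$ and bounded operators $\mathcal{A}=(x_1,\dots,x_n)$ on $H$ for which the operator inequality $$\frac{(n-3)!}{n!}\sum_{\substack{1\le j_1,j_2,j_3\le n\\ \text{all different}}} x_{j_1}^*x_{j_2}^*x_{j_3}^*x_{j_3}x_{j_2}x_{j_1}\;\le\;\frac1{n^3}\sum_{j_1,j_2,j_3=1}^n x_{j_1}^*x_{j_2}^*x_{j_3}^*x_{j_3}x_{j_2}x_{j_1}$$ does not hold.
   Context: For bounded operators $\mathcal{A}=(x_1,\dots,x_n)$ on a Hilbert space and $1\le k\le n$, the without-replacement and with-replacement expectations are $$\mathbb{E}_{\mathrm{wo},k}(\mathcal{A})=\frac{(n-k)!}{n!}\sum_{\substack{1\le j_1,\dots,j_k\le n\\ \text{all different}}}x_{j_1}^*\cdots x_{j_k}^*x_{j_k}\cdots x_{j_1},\qquad \mathbb{E}_{\mathrm{wr},k}(\mathcal{A})=n^{-k}\sum_{j_1,\dots,j_k=1}^n x_{j_1}^*\cdots x_{j_k}^*x_{j_k}\cdots x_{j_1}.$$ The order symmetric AGM conjecture with constant $C_4$ asks whether $\mathbb{E}_{\mathrm{wo},k}(\mathcal{A})\le C_4\,\mathbb{E}_{\mathrm{wr},k}(\mathcal{A})$ always holds, where $\le$ is the usual order on self-adjoint operators ($X\le Y$ iff $Y-X$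 is positive semidefinite). The theorem says this is false with $C_4=1$, length $k=d=3$ and $n\ge3$. *)

theory Defs
  imports
    Complex_Main
    "HOL-Library.Nonpos_Ints"
    "HOL-Algebra.Algebraic_Closure_Type"
begin

section \<open>Complex Hilbert spaces with an explicit carrier\<close>

text \<open>
  HOL formulas cannot quantify existentially over types, so a Hilbert space is an element of a
  record type, which can be bound by an ordinary existential quantifier. The record extends the
  module record of HOL-Algebra by an inner product; as for every module there, the inherited
  fields \<open>mult\<close> and \<open>one\<close> play no role. The scalar ring
  \<open>ring_of_type_algebra :: complex ring\<close> is the field of complex numbers.
\<close>

record 'a inner_space = "(complex, 'a) module" +
  inner_prod :: "'a \<Rightarrow> 'a \<Rightarrow> complex"

definition hnorm :: "('a, 'b) inner_space_scheme \<Rightarrow> 'a \<Rightarrow> real" where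
  "hnorm H u = sqrt (Re (inner_prod H u u))"

text \<open>The inner product is conjugate-linear in the first and linear in the second argument.\<close>

locale hilbert_space = Module.module "ring_of_type_algebra :: complex ring" H
  for H :: "('a, 'b) inner_space_scheme" (structure) +
  assumes inner_commute:
      "\<lbrakk>u \<in> carrier H; v \<in> carrier H\<rbrakk> \<Longrightarrow> inner_prod H u v = cnj (inner_prod H v u)"
    and inner_add_right:
      "\<lbrakk>u \<in> carrier H; v \<in> carrier H; w \<in> carrier H\<rbrakk> \<Longrightarrow>
        inner_prod H u (v \<oplus> w) = inner_prod H u v + inner_prod H u w"
    and inner_scale_right:
      "\<lbrakk>u \<in> carrier H; v \<in> carrier H\<rbrakk> \<Longrightarrow>
        inner_prod H u (c \<odot>\<^bsub>H\<^esub> v) = c * inner_prod H u v"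
    and inner_nonneg: "u \<in> carrier H \<Longrightarrow> inner_prod H u u \<in> \<real>\<^sub>\<ge>\<^sub>0"
    and inner_definite: "\<lbrakk>u \<in> carrier H; inner_prod H u u = 0\<rbrakk> \<Longrightarrow> u = \<zero>"
    and complete:
      "\<lbrakk>\<And>i::nat. s i \<in> carrier H;
        \<And>e. e > 0 \<Longrightarrow> \<exists>N. \<forall>i\<ge>N. \<forall>j\<ge>N. hnorm H (s i \<ominus> s j) < e\<rbrakk> \<Longrightarrow>
        \<exists>l\<in>carrier H. (\<lambda>i. hnorm H (s i \<ominus> l)) \<longlonglongrightarrow> 0"

section \<open>Bounded operators\<close>

text \<open>
  Operators are HOL functions of which only the values on \<open>carrier H\<close> matter.
\<close>

definition bounded_operator :: "('a, 'b) inner_space_scheme \<Rightarrow> ('a \<Rightarrow> 'a) \<Rightarrow> bool" where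
  "bounded_operator H T \<longleftrightarrow>
     T \<in> carrier H \<rightarrow> carrier H \<and>
     (\<forall>u\<in>carrier H. \<forall>v\<in>carrier H. T (u \<oplus>\<^bsub>H\<^esub> v) = T u \<oplus>\<^bsub>H\<^esub> T v) \<and>
     (\<forall>c. \<forall>u\<in>carrier H. T (c \<odot>\<^bsub>H\<^esub> u) = c \<odot>\<^bsub>H\<^esub> T u) \<and>
     (\<exists>C. \<forall>u\<in>carrier H. hnorm H (T u) \<le> C * hnorm H u)"

text \<open>
  For a bounded operator on a Hilbert space the description below is uniquely satisfied, by the
  Riesz representation theorem.
\<close>

definition adjoint_op :: "('a, 'b) inner_space_scheme \<Rightarrow> ('a \<Rightarrow> 'a) \<Rightarrow> 'a \<Rightarrow> 'a" where
  "adjoint_op H T v =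
     (THE w. w \<in> carrier H \<and> (\<forall>u\<in>carrier H. inner_prod H w u = inner_prod H v (T u)))"

definition positive_op :: "('a, 'b) inner_space_scheme \<Rightarrow> ('a \<Rightarrow> 'a) \<Rightarrow> bool" where
  "positive_op H T \<longleftrightarrow> (\<forall>u\<in>carrier H. inner_prod H u (T u) \<in> \<real>\<^sub>\<ge>\<^sub>0)"

definition op_le :: "('a, 'b) inner_space_scheme \<Rightarrow> ('a \<Rightarrow> 'a) \<Rightarrow> ('a \<Rightarrow> 'a) \<Rightarrow> bool" where
  "op_le H S T \<longleftrightarrow> positive_op H (\<lambda>u. T u \<ominus>\<^bsub>H\<^esub> S u)"

section \<open>Expectations without and with replacement\<close>

text \<open>
  For \<open>js = [j\<^sub>1, \<dots>, j\<^sub>k]\<close> this is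
  \<open>x\<^bsub>j\<^sub>1\<^esub>\<^sup>* \<cdots> x\<^bsub>j\<^sub>k\<^esub>\<^sup>* x\<^bsub>j\<^sub>k\<^esub> \<cdots> x\<^bsub>j\<^sub>1\<^esub>\<close>:
  the first index is outermost.
\<close>

primrec sym_word ::
  "('a, 'b) inner_space_scheme \<Rightarrow> (nat \<Rightarrow> 'a \<Rightarrow> 'a) \<Rightarrow> nat list \<Rightarrow> 'a \<Rightarrow> 'a" where
  "sym_word H x [] = id"
| "sym_word H x (j # js) = adjoint_op H (x j) \<circ> sym_word H x js \<circ> x j"

definition expectation_wo ::
  "('a, 'b) inner_space_scheme \<Rightarrow> nat \<Rightarrow> nat \<Rightarrow> (nat \<Rightarrow> 'a \<Rightarrow> 'a) \<Rightarrow> 'a \<Rightarrow> 'a" where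
  "expectation_wo H k n x u =
     (fact (n - k) / fact n) \<odot>\<^bsub>H\<^esub>
       (\<Oplus>\<^bsub>H\<^esub>js\<in>{js. length js = k \<and> set js \<subseteq> {1..n} \<and> distinct js}. sym_word H x js u)"

definition expectation_wr ::
  "('a, 'b) inner_space_scheme \<Rightarrow> nat \<Rightarrow> nat \<Rightarrow> (nat \<Rightarrow> 'a \<Rightarrow> 'a) \<Rightarrow> 'a \<Rightarrow> 'a" where
  "expectation_wr H k n x u =
     (1 / of_nat n ^ k) \<odot>\<^bsub>H\<^esub>
       (\<Oplus>\<^bsub>H\<^esub>js\<in>{js. length js = k \<and> set js \<subseteq> {1..n}}. sym_word H x js u)"

end

theory Submission
  imports Defs
begin

text \<open>
  At a vector \<open>u\<close>, the quadratic forms of the two expectations are averages of \<open>\<parallel>x\<^bsub>j\<^sub>k\<^esub> \<cdots> x\<^bsub>j\<^sub>1\<^esub> u\<parallel>\<^sup>2\<close>,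
  one over the index tuples with distinct entries and one over all tuples. The inequality must break
  as soon as, for some \<open>u\<close>, there are tuples that contribute and all of them have distinct
  entries: the two sums agree, but the first is divided by a smaller number of tuples. A shift that
  is cut into its individual steps does this. In dimension \<open>n + 1\<close>, with the orthonormal basis
  \<open>e\<^sub>0, \<dots>, e\<^sub>n\<close>, let \<open>x\<^sub>j\<close> send \<open>e\<^bsub>j-1\<^esub>\<close> to \<open>e\<^sub>j\<close> and annihilate the other basis vectors. Starting
  from \<open>e\<^sub>0\<close>, the only product of \<open>k\<close> of these operators that survives is \<open>x\<^sub>k \<cdots> x\<^sub>1\<close>
  (lemma \<open>sym_word_step\<close>), so the two expectations multiply \<open>e\<^sub>0\<close> by
  \<open>(n - k)! / n!\<close> and \<open>1 / n\<^sup>k\<close>, and the first is larger whenever \<open>2 \<le> k \<le> n\<close> (lemma \<open>fact_less_power_mult_fact\<close>).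
\<close>

section \<open>Coordinate spaces\<close>

text \<open>
  Tuples are extended by zeros to sequences so that all dimensions share one type.
\<close>

definition coord_space :: "nat \<Rightarrow> (nat \<Rightarrow> complex) inner_space" where
  "coord_space d =
     \<lparr>carrier = {u. \<forall>i\<ge>d. u i = 0}, monoid.mult = undefined, one = undefined,
      ring.zero = (\<lambda>i. 0), add = (\<lambda>u v i. u i + v i), module.smult = (\<lambda>c u i. c * u i),
      inner_prod = (\<lambda>u v. \<Sum>i<d. cnj (u i) * v i)\<rparr>"

lemma coord_space_simps [simp]:
  "u \<in> carrier (coord_space d) \<longleftrightarrow> (\<forall>i\<ge>d. u i = 0)"
  "\<zero>\<^bsub>coord_space d\<^esub> = (\<lambda>i. 0)"
  "u \<oplus>\<^bsub>coord_space d\<^esub> v = (\<lambda>i. u i + v i)"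
  "c \<odot>\<^bsub>coord_space d\<^esub> u = (\<lambda>i. c * u i)"
  "inner_prod (coord_space d) u v = (\<Sum>i<d. cnj (u i) * v i)"
  by (simp_all add: coord_space_def)

lemma module_coord_space:
  "Module.module (ring_of_type_algebra :: complex ring) (coord_space d)"
proof (rule Module.moduleI[OF cring_from_type_algebra])
  show "abelian_group (coord_space d)"
  proof (rule abelian_groupI)
    fix u :: "nat \<Rightarrow> complex" assume "u \<in> carrier (coord_space d)"
    then show "\<exists>v\<in>carrier (coord_space d). v \<oplus>\<^bsub>coord_space d\<^esub> u = \<zero>\<^bsub>coord_space d\<^esub>"
      by (intro bexI[of _ "\<lambda>i. - u i"]) auto
  qed (auto simp: algebra_simps)
qed (auto simp: ring_of_type_algebra_def algebra_simps)

lemma minus_coord_space [simp]: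
  assumes "v \<in> carrier (coord_space d)"
  shows "u \<ominus>\<^bsub>coord_space d\<^esub> v = (\<lambda>i. u i - v i)"
proof -
  interpret Module.module "ring_of_type_algebra :: complex ring" "coord_space d"
    by (rule module_coord_space)
  have "\<ominus>\<^bsub>coord_space d\<^esub> v = (\<lambda>i. - v i)"
    using assms by (intro minus_equality) auto
  then show ?thesis by (simp add: a_minus_def)
qed

lemma inner_prod_self_coord_space:
  "(\<Sum>i<d. cnj (u i) * u i) = of_real (\<Sum>i<d. (cmod (u i))\<^sup>2)"
  by (simp add: complex_norm_square mult.commute del: of_real_power)

lemma hnorm_coord_space: "hnorm (coord_space d) u = sqrt (\<Sum>i<d. (cmod (u i))\<^sup>2)"
  by (simp add: hnorm_def inner_prod_self_coord_space)

lemma norm_coord_le_hnorm: "i < d \<Longrightarrow> cmod (u i) \<le> hnorm (coord_space d) u"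
  unfolding hnorm_coord_space by (rule real_le_rsqrt) (auto intro: member_le_sum)

text \<open>Completeness is inherited from \<open>\<complex>\<close>: the limit is taken in each coordinate.\<close>

lemma coord_space_complete:
  assumes carr: "\<And>i::nat. s i \<in> carrier (coord_space d)"
    and cauchy: "\<And>e. e > 0 \<Longrightarrow>
      \<exists>N. \<forall>i\<ge>N. \<forall>j\<ge>N. hnorm (coord_space d) (s i \<ominus>\<^bsub>coord_space d\<^esub> s j) < e"
  shows "\<exists>l\<in>carrier (coord_space d).
    (\<lambda>i. hnorm (coord_space d) (s i \<ominus>\<^bsub>coord_space d\<^esub> l)) \<longlonglongrightarrow> 0"
proof -
  have conv: "convergent (\<lambda>i. s i k)" for k
  proof (cases "k < d")
    case True
    have "Cauchy (\<lambda>i. s i k)"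
    proof (rule metric_CauchyI)
      fix e :: real assume "e > 0"
      from cauchy[OF this] obtain N where
        N: "\<And>i j. i \<ge> N \<Longrightarrow> j \<ge> N \<Longrightarrow> hnorm (coord_space d) (\<lambda>k. s i k - s j k) < e"
        using carr by (auto simp del: coord_space_simps)
      have "dist (s i k) (s j k) < e" if "i \<ge> N" "j \<ge> N" for i j
        using norm_coord_le_hnorm[OF True, of "\<lambda>k. s i k - s j k"] N[OF that]
        by (simp add: dist_norm)
      then show "\<exists>M. \<forall>m\<ge>M. \<forall>n\<ge>M. dist (s m k) (s n k) < e" by blast
    qed
    then show ?thesis by (simp add: Cauchy_convergent_iff)
  next
    case False
    then have "(\<lambda>i. s i k) = (\<lambda>i. 0)" using carr by auto
    then show ?thesis by (simp add: convergent_const)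
  qed
  define l where "l k = lim (\<lambda>i. s i k)" for k
  have lim: "(\<lambda>i. s i k) \<longlonglongrightarrow> l k" for k
    using conv[of k] by (simp add: l_def convergent_LIMSEQ_iff)
  have l: "l \<in> carrier (coord_space d)"
    using carr by (auto simp: l_def)
  have "(\<lambda>i. sqrt (\<Sum>k<d. (cmod (s i k - l k))\<^sup>2)) \<longlonglongrightarrow> sqrt (\<Sum>k<d. (cmod (l k - l k))\<^sup>2)"
    by (intro tendsto_intros lim)
  then have "(\<lambda>i. hnorm (coord_space d) (s i \<ominus>\<^bsub>coord_space d\<^esub> l)) \<longlonglongrightarrow> 0"
    using l by (simp add: hnorm_coord_space)
  with l show ?thesis by blast
qed

lemma hilbert_space_coord_space: "hilbert_space (coord_space d)"
proof (intro hilbert_space.intro module_coord_space hilbert_space_axioms.intro coord_space_complete)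
  fix u :: "nat \<Rightarrow> complex" assume u: "u \<in> carrier (coord_space d)"
  show "inner_prod (coord_space d) u u \<in> \<real>\<^sub>\<ge>\<^sub>0"
    by (simp only: coord_space_simps inner_prod_self_coord_space nonneg_Reals_of_real_iff)
      (simp add: sum_nonneg)
  assume "inner_prod (coord_space d) u u = 0"
  then have "(\<Sum>i<d. (cmod (u i))\<^sup>2) = 0"
    by (simp only: coord_space_simps inner_prod_self_coord_space of_real_eq_0_iff)
  then have "u i = 0" if "i < d" for i
    using that by (simp add: sum_nonneg_eq_0_iff)
  with u show "u = \<zero>\<^bsub>coord_space d\<^esub>"
    by (auto simp: fun_eq_iff) (meson not_le)
qed (auto simp: algebra_simps sum.distrib sum_distrib_left)

section \<open>Matrix units\<close>

definition unit_vec :: "nat \<Rightarrow> nat \<Rightarrow> complex" where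
  "unit_vec m = (\<lambda>i. if i = m then 1 else 0)"

definition matrix_unit :: "nat \<Rightarrow> nat \<Rightarrow> (nat \<Rightarrow> complex) \<Rightarrow> nat \<Rightarrow> complex" where
  "matrix_unit i j u = (\<lambda>k. if k = i then u j else 0)"

lemma matrix_unit_unit_vec:
  "matrix_unit i j (unit_vec m) = (if j = m then unit_vec i else (\<lambda>k. 0))"
  by (auto simp: matrix_unit_def unit_vec_def)

lemma matrix_unit_zero [simp]: "matrix_unit i j (\<lambda>k. 0) = (\<lambda>k. 0)"
  by (simp add: matrix_unit_def)

lemma bounded_operator_matrix_unit:
  assumes "i < d" "j < d"
  shows "bounded_operator (coord_space d) (matrix_unit i j)"
proof -
  have "hnorm (coord_space d) (matrix_unit i j u) \<le> 1 * hnorm (coord_space d) u" for u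
  proof -
    have "(\<Sum>k<d. (cmod (matrix_unit i j u k))\<^sup>2) = (\<Sum>k<d. if k = i then (cmod (u j))\<^sup>2 else 0)"
      by (intro sum.cong) (auto simp: matrix_unit_def)
    also have "\<dots> = (cmod (u j))\<^sup>2"
      using assms by simp
    finally show ?thesis
      using norm_coord_le_hnorm[OF assms(2), of u] by (simp add: hnorm_coord_space)
  qed
  then have "\<exists>C. \<forall>u\<in>carrier (coord_space d).
      hnorm (coord_space d) (matrix_unit i j u) \<le> C * hnorm (coord_space d) u"
    by blast
  moreover have "matrix_unit i j \<in> carrier (coord_space d) \<rightarrow> carrier (coord_space d)"
    using assms by (auto simp: matrix_unit_def)
  ultimately show ?thesis
    by (simp add: bounded_operator_def) (simp add: matrix_unit_def fun_eq_iff)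
qed

lemma inner_prod_unit_vec_right:
  "m < d \<Longrightarrow> inner_prod (coord_space d) u (unit_vec m) = cnj (u m)"
  by (simp add: unit_vec_def if_distrib cong: if_cong)

lemma adjoint_matrix_unit:
  assumes "i < d" "j < d"
  shows "adjoint_op (coord_space d) (matrix_unit i j) v = matrix_unit j i v"
  unfolding adjoint_op_def
proof (rule the_equality)
  have "(\<Sum>k<d. cnj (matrix_unit j i v k) * u k) = (\<Sum>k<d. cnj (v k) * matrix_unit i j u k)"
    for u
    using assms by (simp add: matrix_unit_def if_distrib if_distribR cong: if_cong)
  then show *: "matrix_unit j i v \<in> carrier (coord_space d) \<and>
      (\<forall>u\<in>carrier (coord_space d). inner_prod (coord_space d) (matrix_unit j i v) u =
        inner_prod (coord_space d) v (matrix_unit i j u))"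
    using assms by (auto simp: matrix_unit_def)
  fix w
  assume w: "w \<in> carrier (coord_space d) \<and> (\<forall>u\<in>carrier (coord_space d).
      inner_prod (coord_space d) w u = inner_prod (coord_space d) v (matrix_unit i j u))"
  have "w m = matrix_unit j i v m" for m
  proof (cases "m < d")
    case True
    then have "unit_vec m \<in> carrier (coord_space d)"
      by (simp add: unit_vec_def)
    with w * have "inner_prod (coord_space d) w (unit_vec m) =
        inner_prod (coord_space d) (matrix_unit j i v) (unit_vec m)"
      by (metis (no_types))
    then show ?thesis
      unfolding inner_prod_unit_vec_right[OF True] by simp
  next
    case False
    then show ?thesis using w * by (metis coord_space_simps(1) not_le)
  qed
  then show "w = matrix_unit j i v" by blast
qed

section \<open>The steps of a shift\<close>

abbreviation step :: "nat \<Rightarrow> (nat \<Rightarrow> complex) \<Rightarrow> nat \<Rightarrow> complex" where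
  "step j \<equiv> matrix_unit j (j - 1)"

lemma sym_word_step_zero:
  "set js \<subseteq> {1..n} \<Longrightarrow> sym_word (coord_space (Suc n)) step js (\<lambda>k. 0) = (\<lambda>k. 0)"
  by (induction js) (auto simp: adjoint_matrix_unit)

text \<open>
  The vector \<open>e\<^sub>m\<close> survives only the step \<open>m + 1\<close>, which turns it into \<open>e\<^bsub>m+1\<^esub>\<close>; so the indices of
  a word that does not annihilate it are forced, one after the other. The adjoints then
  walk the same way back.
\<close>

lemma sym_word_step:
  assumes "set js \<subseteq> {1..n}"
  shows "sym_word (coord_space (Suc n)) step js (unit_vec m) =
    (if js = [Suc m..<Suc m + length js] then unit_vec m else (\<lambda>k. 0))"
  using assms
proof (induction js arbitrary: m)
  case Nil
  then show ?case by simp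
next
  case (Cons j js)
  then have j: "1 \<le> j" "j \<le> n" and js: "set js \<subseteq> {1..n}" by auto
  have upt: "[Suc m..<Suc m + length (j # js)] = Suc m # [Suc (Suc m)..<Suc (Suc m) + length js]"
    by (simp add: upt_rec)
  show ?case
  proof (cases "j = Suc m")
    case True
    then show ?thesis
      using j Cons.IH[OF js, of "Suc m"] unfolding upt
      by (simp add: adjoint_matrix_unit matrix_unit_unit_vec)
  next
    case False
    then have "step j (unit_vec m) = (\<lambda>k. 0)"
      using j by (auto simp: matrix_unit_unit_vec)
    then show ?thesis
      using j False sym_word_step_zero[OF js] unfolding upt by (simp add: adjoint_matrix_unit)
  qed
qed

lemma finsum_sym_word_step:
  assumes "finite J" "\<And>js. js \<in> J \<Longrightarrow> length js = k \<and> set js \<subseteq> {1..n}" "[1..<Suc k] \<in> J"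
  shows "(\<Oplus>\<^bsub>coord_space (Suc n)\<^esub>js\<in>J. sym_word (coord_space (Suc n)) step js (unit_vec 0)) =
    unit_vec 0"
proof -
  interpret Module.module "ring_of_type_algebra :: complex ring" "coord_space (Suc n)"
    by (rule module_coord_space)
  have e0: "unit_vec 0 \<in> carrier (coord_space (Suc n))"
    by (simp add: unit_vec_def)
  have "(\<Oplus>\<^bsub>coord_space (Suc n)\<^esub>js\<in>J. sym_word (coord_space (Suc n)) step js (unit_vec 0)) =
      (\<Oplus>\<^bsub>coord_space (Suc n)\<^esub>js\<in>J.
        if [1..<Suc k] = js then unit_vec 0 else \<zero>\<^bsub>coord_space (Suc n)\<^esub>)"
  proof (rule finsum_cong')
    fix js assume "js \<in> J"
    then have "length js = k" "set js \<subseteq> {1..n}"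
      using assms(2) by blast+
    then show "sym_word (coord_space (Suc n)) step js (unit_vec 0) =
        (if [1..<Suc k] = js then unit_vec 0 else \<zero>\<^bsub>coord_space (Suc n)\<^esub>)"
      using sym_word_step[of js n 0] by (auto simp del: upt_Suc)
  qed (use e0 in auto)
  also have "\<dots> = unit_vec 0"
    using assms(1,3) e0 by (intro finsum_singleton) auto
  finally show ?thesis .
qed

lemma expectation_wr_step:
  assumes "k \<le> n"
  shows "expectation_wr (coord_space (Suc n)) k n step (unit_vec 0) =
    (\<lambda>i. 1 / of_nat n ^ k * unit_vec 0 i)"
proof -
  have "finite {js. length js = k \<and> set js \<subseteq> {1..n}}"
    using finite_lists_length_eq[of "{1..n}" k] by (simp add: conj_commute)
  then show ?thesis
    using assms unfolding expectation_wr_def by (subst finsum_sym_word_step[where k = k]) auto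
qed

lemma expectation_wo_step:
  assumes "k \<le> n"
  shows "expectation_wo (coord_space (Suc n)) k n step (unit_vec 0) =
    (\<lambda>i. fact (n - k) / fact n * unit_vec 0 i)"
proof -
  have "finite {js. length js = k \<and> set js \<subseteq> {1..n} \<and> distinct js}"
    by (rule finite_subset[OF _ finite_lists_length_eq[of "{1..n}" k]]) auto
  then show ?thesis
    using assms unfolding expectation_wo_def by (subst finsum_sym_word_step[where k = k]) auto
qed

section \<open>Failure of the inequality\<close>

text \<open>
  The falling factorial \<open>n (n - 1) \<cdots> (n - k + 1)\<close> is smaller than \<open>n\<^sup>k\<close>, because
  \<open>k \<ge> 2\<close> makes its second factor smaller than \<open>n\<close>.
\<close>

lemma fact_less_power_mult_fact:
  assumes "2 \<le> k" "k \<le> n"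
  shows "(fact n :: nat) < n ^ k * fact (n - k)"
  using assms
proof (induction k rule: dec_induct)
  case base
  then obtain m where "n = Suc (Suc m)"
    by (metis add_2_eq_Suc le_Suc_ex)
  then have n: "fact n = (Suc (Suc m) * Suc m) * (fact m :: nat)" "n - 2 = m"
    by (simp_all add: algebra_simps)
  have "Suc (Suc m) * Suc m < n ^ 2"
    using \<open>n = Suc (Suc m)\<close> by (simp add: power2_eq_square)
  then show ?case unfolding n by (intro mult_strict_right_mono) auto
next
  case (step k)
  then have "n - k = Suc (n - Suc k)" by simp
  then have "(fact (n - k) :: nat) = (n - k) * fact (n - Suc k)"
    by (metis fact_Suc of_nat_id)
  also have "\<dots> \<le> n * fact (n - Suc k)" by simp
  finally have "n ^ k * fact (n - k) \<le> n ^ k * (n * fact (n - Suc k))"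
    by (rule mult_le_mono2)
  moreover have "fact n < n ^ k * fact (n - k)"
    using step by simp
  ultimately show ?case
    by (simp only: power_Suc2 mult.assoc)
qed

theorem not_op_le_expectation_step:
  assumes "2 \<le> k" "k \<le> n"
  shows "\<not> op_le (coord_space (Suc n)) (expectation_wo (coord_space (Suc n)) k n step)
    (expectation_wr (coord_space (Suc n)) k n step)"
proof
  let ?H = "coord_space (Suc n)"
  assume le: "op_le ?H (expectation_wo ?H k n step) (expectation_wr ?H k n step)"
  have carr: "unit_vec 0 \<in> carrier ?H" "(\<lambda>i. fact (n - k) / fact n * unit_vec 0 i) \<in> carrier ?H"
    by (simp_all add: unit_vec_def)
  have "inner_prod ?H (unit_vec 0)
      (expectation_wr ?H k n step (unit_vec 0) \<ominus>\<^bsub>?H\<^esub> expectation_wo ?H k n step (unit_vec 0))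
      \<in> \<real>\<^sub>\<ge>\<^sub>0"
    using le carr(1) unfolding op_le_def positive_op_def by (rule bspec)
  then have "inner_prod ?H (unit_vec 0)
      (\<lambda>i. 1 / of_nat n ^ k * unit_vec 0 i - fact (n - k) / fact n * unit_vec 0 i) \<in> \<real>\<^sub>\<ge>\<^sub>0"
    unfolding expectation_wo_step[OF assms(2)] expectation_wr_step[OF assms(2)]
      minus_coord_space[OF carr(2)] .
  then have "1 / of_nat n ^ k - fact (n - k) / fact n \<in> (\<real>\<^sub>\<ge>\<^sub>0 :: complex set)"
    using assms by (simp add: unit_vec_def if_distrib if_distribR cong: if_cong)
  moreover have "1 / of_nat n ^ k - fact (n - k) / fact n =
      (of_real (1 / real n ^ k - fact (n - k) / fact n) :: complex)"
    by simp
  ultimately have "1 / real n ^ k \<ge> fact (n - k) / fact n"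
    by (metis nonneg_Reals_of_real_iff diff_ge_0_iff_ge)
  then have "real n ^ k * fact (n - k) \<le> fact n"
    using assms by (simp add: field_simps)
  moreover have "real (fact n) < real (n ^ k * fact (n - k))"
    using fact_less_power_mult_fact[OF assms] of_nat_less_iff by blast
  ultimately show False by simp
qed

theorem theorem1p1:
  fixes n :: nat
  assumes "n \<ge> 3"
  shows "\<exists>(H :: (nat \<Rightarrow> complex) inner_space) (x :: nat \<Rightarrow> (nat \<Rightarrow> complex) \<Rightarrow> (nat \<Rightarrow> complex)).
           hilbert_space H \<and>
           (\<forall>j\<in>{1..n}. bounded_operator H (x j)) \<and>
           \<not> op_le H (expectation_wo H 3 n x) (expectation_wr H 3 n x)"
proof (intro exI conjI ballI)
  show "hilbert_space (coord_space (Suc n))"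
    by (rule hilbert_space_coord_space)
  show "bounded_operator (coord_space (Suc n)) (step j)" if "j \<in> {1..n}" for j
    using that by (intro bounded_operator_matrix_unit) auto
  show "\<not> op_le (coord_space (Suc n)) (expectation_wo (coord_space (Suc n)) 3 n step)
      (expectation_wr (coord_space (Suc n)) 3 n step)"
    using assms by (intro not_op_le_expectation_step) auto
qed

end
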